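(* Let a group $G$ act by homeomorphisms on a topological space $X$, and suppose that the action has a dense orbit. For every $d\geq1$, the number of $G$-partitions of $X$ into exactly $d$ clopen subsets is bounded above by the number of subgroups of index $d$ in $G$. In particular, if $G$ has only finitely many subgroups of index $d$, then there are only finitely many such partitions. This holds, in particular, when $G$ is finitely generated.
   Context: A $G$-partition of $X$ is a partition of $X$ into (nonempty) parts that is invariant under $G$, i.e. for every $g\in G$ and every part $C$, the set $gC$ is again a part. *)

theory Defs
  imports
    "HOL-Algebra.Group_Action"
    "HOL-Algebra.Generated_Groups"
    "HOL-Analysis.Abstract_Topology"
    "HOL-Library.Disjoint_Sets"
    "HOL-Library.Equipollence"
begin

text \<open>
  The library locale \<^locale>\<open>group_action\<close> makes each \<open>\<phi> g\<close> an extensional bijection of the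
  carrier set; here the carrier set is the underlying set of the topology.
\<close>

definition acts_by_homeomorphisms ::
  "('g, 'm) monoid_scheme \<Rightarrow> 'a topology \<Rightarrow> ('g \<Rightarrow> 'a \<Rightarrow> 'a) \<Rightarrow> bool"
  where "acts_by_homeomorphisms G X \<phi> \<longleftrightarrow>
    group_action G (topspace X) \<phi> \<and> (\<forall>g\<in>carrier G. homeomorphic_map X X (\<phi> g))"

definition has_dense_orbit ::
  "('g, 'm) monoid_scheme \<Rightarrow> 'a topology \<Rightarrow> ('g \<Rightarrow> 'a \<Rightarrow> 'a) \<Rightarrow> bool"
  where "has_dense_orbit G X \<phi> \<longleftrightarrow>
    (\<exists>x\<in>topspace X. X closure_of (orbit G \<phi> x) = topspace X)"

definition G_partition ::
  "('g, 'm) monoid_scheme \<Rightarrow> 'a set \<Rightarrow> ('g \<Rightarrow> 'a \<Rightarrow> 'a) \<Rightarrow> 'a set set \<Rightarrow> bool"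
  where "G_partition G E \<phi> P \<longleftrightarrow>
    partition_on E P \<and> (\<forall>g\<in>carrier G. \<forall>C\<in>P. \<phi> g ` C \<in> P)"

text \<open>
  In the next two definitions \<open>d\<close> is meant to be positive; since \<^const>\<open>card\<close> is 0 on infinite
  sets, only then does the cardinality condition also say that the set is finite.
\<close>

definition clopen_G_partitions ::
  "('g, 'm) monoid_scheme \<Rightarrow> 'a topology \<Rightarrow> ('g \<Rightarrow> 'a \<Rightarrow> 'a) \<Rightarrow> nat \<Rightarrow> 'a set set set"
  where "clopen_G_partitions G X \<phi> d =
    {P. G_partition G (topspace X) \<phi> P \<and> (\<forall>C\<in>P. openin X C \<and> closedin X C) \<and> card P = d}"

definition subgroups_of_index :: "('g, 'm) monoid_scheme \<Rightarrow> nat \<Rightarrow> 'g set set"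
  where "subgroups_of_index G d = {H. subgroup H G \<and> card (rcosets\<^bsub>G\<^esub> H) = d}"

definition finitely_generated_group :: "('g, 'm) monoid_scheme \<Rightarrow> bool"
  where "finitely_generated_group G \<longleftrightarrow>
    group G \<and> (\<exists>S. finite S \<and> S \<subseteq> carrier G \<and> generate G S = carrier G)"

end

theory Submission
  imports Defs
begin

text \<open>
  Fix a point \<open>x\<close> with dense orbit \<open>O\<close> and send a clopen \<open>G\<close>-partition to the stabilizer \<open>H\<close> of
  its part \<open>C\<close> containing \<open>x\<close>. Every part is open and so meets \<open>O\<close>; hence \<open>G\<close> permutes the parts
  transitively and \<open>H\<close> has index \<open>d\<close>. The subgroup determines the partition: \<open>H x = O \<inter> C\<close> is dense
  in the clopen set \<open>C\<close>, so \<open>C\<close> is the closure of \<open>H x\<close>, and the other parts are the translates of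
  \<open>C\<close>.

  If \<open>G\<close> is generated by a finite set \<open>S\<close>, number the cosets of a subgroup of index \<open>d\<close>. The subgroup
  is recovered from the number of the trivial coset and the finite table of how the elements of \<open>S\<close>
  and their inverses move the numbers around.
\<close>

text \<open>Letting \<open>G\<close> act on the parts makes orbit and stabilizer facts available for
  them. Restriction to \<open>P\<close> makes each map extensional, as membership in
  \<open>Bij P\<close> demands.\<close>

lemma (in group_action) action_on_partition:
  assumes "G_partition G E \<phi> P"
  shows "group_action G P (\<lambda>g. \<lambda>C\<in>P. \<phi> g ` C)"
proof -
  interpret group G using group_hom by (simp add: group_hom_def)
  let ?\<psi> = "\<lambda>g. \<lambda>C\<in>P. \<phi> g ` C"
  have sub: "C \<subseteq> E" if "C \<in> P" for C
    using assms that by (auto simp: G_partition_def partition_on_def)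
  have closed: "\<phi> g ` C \<in> P" if "g \<in> carrier G" "C \<in> P" for g C
    using assms that by (auto simp: G_partition_def)
  have comp: "\<phi> (g \<otimes> h) ` C = \<phi> g ` \<phi> h ` C"
    if "g \<in> carrier G" "h \<in> carrier G" "C \<in> P" for g h C
    unfolding image_image using that sub by (intro image_cong refl composition_rule) auto
  have one: "\<phi> \<one> ` C = C" if "C \<in> P" for C
    using sub[OF that] id_eq_one[symmetric] by (force simp: subset_iff)
  have bij: "?\<psi> g \<in> Bij P" if g: "g \<in> carrier G" for g
  proof -
    have "bij_betw (?\<psi> g) P P"
    proof (rule bij_betw_byWitness[where f' = "?\<psi> (inv g)"])
      show "\<forall>C\<in>P. ?\<psi> (inv g) (?\<psi> g C) = C" "\<forall>C\<in>P. ?\<psi> g (?\<psi> (inv g) C) = C"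
        using g by (auto simp: closed one simp flip: comp)
    qed (use g closed in auto)
    then show ?thesis by (simp add: Bij_def)
  qed
  have "?\<psi> \<in> hom G (BijGroup P)"
  proof (rule homI)
    fix g h assume "g \<in> carrier G" "h \<in> carrier G"
    then show "?\<psi> (g \<otimes> h) = ?\<psi> g \<otimes>\<^bsub>BijGroup P\<^esub> ?\<psi> h"
      by (auto simp: BijGroup_def bij compose_def fun_eq_iff comp closed)
  qed (simp add: BijGroup_def bij)
  then show ?thesis
    by (simp add: group_action_def group_hom_def group_hom_axioms_def group_BijGroup is_group)
qed

text \<open>Orbit-stabilizer as a bijection between cosets and orbit points; for an infinite orbit
  both cardinalities are 0.\<close>

lemma (in group_action) card_rcosets_stabilizer:
  assumes "x \<in> E"
  shows "card (rcosets (stabilizer G \<phi> x)) = card (orbit G \<phi> x)"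
  using orbit_stab_fun_is_bij[OF assms] bij_betw_same_card by blast

text \<open>The image of \<open>C\<close> is again a part and distinct parts are disjoint, so the
  single point \<open>\<phi> g y\<close> decides which part it is.\<close>

lemma G_partition_image_eq_iff:
  assumes "group_action G E \<phi>" "G_partition G E \<phi> P" "g \<in> carrier G"
    and "C \<in> P" "D \<in> P" "y \<in> C"
  shows "\<phi> g ` C = D \<longleftrightarrow> \<phi> g y \<in> D"
proof
  assume "\<phi> g y \<in> D"
  moreover have "\<phi> g ` C \<in> P" "disjoint P"
    using assms by (auto simp: G_partition_def partition_on_def)
  ultimately show "\<phi> g ` C = D"
    using assms(5,6) unfolding disjoint_def by blast
qed (use assms in auto)

lemma dense_orbit_transitive_on_open_partition:
  assumes "X closure_of (orbit G \<phi> x) = topspace X"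
    and "group_action G (topspace X) \<phi>" "G_partition G (topspace X) \<phi> P"
    and "C \<in> P" "x \<in> C" "D \<in> P" "openin X D"
  obtains g where "g \<in> carrier G" "\<phi> g ` C = D"
proof -
  have "D \<noteq> {}"
    using assms by (auto simp: G_partition_def partition_on_def)
  then have "orbit G \<phi> x \<inter> D \<noteq> {}"
    using assms(1,7) by (simp add: dense_intersects_open)
  then obtain g where "g \<in> carrier G" "\<phi> g x \<in> D"
    by (auto simp: orbit_def)
  then show ?thesis
    using that G_partition_image_eq_iff[OF assms(2,3)] assms(4-6) by blast
qed

text \<open>Openness of \<open>C\<close> allows \<open>S\<close> to be replaced by its closure
  inside the intersection; closedness makes \<open>C\<close> its own closure.\<close>

lemma clopen_eq_closure_of_dense_Int:
  assumes "X closure_of S = topspace X" "openin X C" "closedin X C"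
  shows "C = X closure_of (C \<inter> S)"
proof -
  have "X closure_of (C \<inter> S) = X closure_of (C \<inter> topspace X)"
    using closure_of_openin_Int_closure_of[OF assms(2), of S] assms(1) by simp
  also have "\<dots> = C"
    using openin_subset[OF assms(2)] assms(3) by (simp add: Int_absorb2 closure_of_closedin)
  finally show ?thesis ..
qed

lemma clopen_G_partitions_lepoll_subgroups:
  assumes "acts_by_homeomorphisms G X \<phi>" "has_dense_orbit G X \<phi>"
  shows "clopen_G_partitions G X \<phi> d \<lesssim> subgroups_of_index G d"
proof -
  have act: "group_action G (topspace X) \<phi>"
    using assms by (simp add: acts_by_homeomorphisms_def)
  obtain x where x: "x \<in> topspace X" and dense: "X closure_of (orbit G \<phi> x) = topspace X"
    using assms by (auto simp: has_dense_orbit_def)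
  \<comment> \<open>The existential makes \<open>stab\<close> a function of \<open>P\<close> alone,
    with no choice of part. Testing only the image of \<open>x\<close> suffices, since images of
    parts are parts.\<close>
  define stab where "stab P = {g \<in> carrier G. \<exists>C\<in>P. x \<in> C \<and> \<phi> g x \<in> C}" for P
  have stab_eq: "stab P = {g \<in> carrier G. \<phi> g x \<in> C}"
    if "G_partition G (topspace X) \<phi> P" "C \<in> P" "x \<in> C" for P C
  proof -
    have "disjoint P"
      using that(1) by (auto simp: G_partition_def partition_on_def)
    then have "D = C" if "D \<in> P" "x \<in> D" for D
      using disjointD[OF _ that(1) \<open>C \<in> P\<close>] that(2) \<open>x \<in> C\<close> by blast
    with that(2,3) show ?thesis
      unfolding stab_def by blast
  qed
  have part: "\<exists>C\<in>P. x \<in> C" if "G_partition G (topspace X) \<phi> P" for P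
    using that x by (auto simp: G_partition_def partition_on_def)
  have "stab P \<in> subgroups_of_index G d" if P: "P \<in> clopen_G_partitions G X \<phi> d" for P
  proof -
    have gp: "G_partition G (topspace X) \<phi> P" and "card P = d" and op: "\<forall>C\<in>P. openin X C"
      using P by (auto simp: clopen_G_partitions_def)
    obtain C where C: "C \<in> P" "x \<in> C"
      using part[OF gp] by blast
    define \<psi> where "\<psi> = (\<lambda>g. \<lambda>C\<in>P. \<phi> g ` C)"
    interpret parts: group_action G P \<psi>
      unfolding \<psi>_def by (rule group_action.action_on_partition[OF act gp])
    have "stab P = stabilizer G \<psi> C"
      using C G_partition_image_eq_iff[OF act gp _ C(1) C(1) C(2)]
      by (auto simp: stab_eq[OF gp C] stabilizer_def \<psi>_def)
    moreover have "orbit G \<psi> C = P"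
    proof
      show "orbit G \<psi> C \<subseteq> P"
        using C(1) parts.element_image by (auto simp: orbit_def)
      show "P \<subseteq> orbit G \<psi> C"
      proof
        fix D assume "D \<in> P"
        then obtain g where "g \<in> carrier G" "\<phi> g ` C = D"
          using dense_orbit_transitive_on_open_partition[OF dense act gp C] op by blast
        then show "D \<in> orbit G \<psi> C"
          using C(1) by (auto simp: orbit_def \<psi>_def)
      qed
    qed
    ultimately show ?thesis
      using parts.stabilizer_subgroup[OF C(1)] parts.card_rcosets_stabilizer[OF C(1)] \<open>card P = d\<close>
      by (simp add: subgroups_of_index_def)
  qed
  moreover have "inj_on stab (clopen_G_partitions G X \<phi> d)"
  proof (rule inj_onI)
    fix P Q assume P: "P \<in> clopen_G_partitions G X \<phi> d" and Q: "Q \<in> clopen_G_partitions G X \<phi> d"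
      and eq: "stab P = stab Q"
    have gpP: "G_partition G (topspace X) \<phi> P" and clP: "\<forall>C\<in>P. openin X C \<and> closedin X C"
      and gpQ: "G_partition G (topspace X) \<phi> Q" and clQ: "\<forall>C\<in>Q. openin X C \<and> closedin X C"
      using P Q by (auto simp: clopen_G_partitions_def)
    obtain C D where C: "C \<in> P" "x \<in> C" and D: "D \<in> Q" "x \<in> D"
      using part gpP gpQ by meson
    \<comment> \<open>An orbit point \<open>\<phi> g x\<close> lies in \<open>C\<close> exactly when
      \<open>g \<in> stab P\<close>, and in \<open>D\<close> exactly when
      \<open>g \<in> stab Q\<close>.\<close>
    have "C \<inter> orbit G \<phi> x = D \<inter> orbit G \<phi> x"
      using eq unfolding stab_eq[OF gpP C] stab_eq[OF gpQ D] by (auto simp: orbit_def)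
    then have CD: "C = D"
      using clopen_eq_closure_of_dense_Int[OF dense] C(1) D(1) clP clQ by metis
    have translates: "R = (\<lambda>g. \<phi> g ` C) ` carrier G"
      if "G_partition G (topspace X) \<phi> R" "\<forall>C\<in>R. openin X C \<and> closedin X C" "C \<in> R" for R
    proof
      show "R \<subseteq> (\<lambda>g. \<phi> g ` C) ` carrier G"
        using dense_orbit_transitive_on_open_partition[OF dense act that(1,3) C(2)] that(2) by blast
    qed (use that in \<open>auto simp: G_partition_def\<close>)
    show "P = Q"
      using translates[OF gpP clP] translates[OF gpQ clQ] C(1) D(1) CD by simp
  qed
  ultimately show ?thesis
    unfolding lepoll_def by blast
qed

text \<open>
  Such maps \<open>c\<close> are the numberings, with possible gaps, of the classes of a right-invariant
  equivalence relation on \<open>G\<close>.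
\<close>

definition right_invariant_colourings :: "('g, 'm) monoid_scheme \<Rightarrow> nat \<Rightarrow> ('g \<Rightarrow> nat) set"
  where "right_invariant_colourings G d =
    {c \<in> carrier G \<rightarrow>\<^sub>E {..<d}. \<forall>g\<in>carrier G. \<forall>h\<in>carrier G. \<forall>t\<in>carrier G.
       c g = c h \<longrightarrow> c (g \<otimes>\<^bsub>G\<^esub> t) = c (h \<otimes>\<^bsub>G\<^esub> t)}"

lemma (in group) finite_right_invariant_colourings:
  assumes "finite S" "S \<subseteq> carrier G" "generate G S = carrier G"
  shows "finite (right_invariant_colourings G d)"
proof -
  let ?A = "right_invariant_colourings G d"
  \<comment> \<open>Inverses are included because \<open>generate\<close> also admits inverses of
    generators.\<close>
  define T where "T = S \<union> m_inv G ` S"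
  have T: "finite T" "T \<subseteq> carrier G"
    using assms by (auto simp: T_def)
  \<comment> \<open>Each triple holds the acting element, the colour before and the colour after.
    Group elements outside \<open>T\<close> leave no trace but their colours, so only finitely many
    tables exist.\<close>
  define tab where
    "tab c = (c \<one>, {(s, c g, c (g \<otimes> s)) | s g. s \<in> T \<and> g \<in> carrier G})" for c :: "'a \<Rightarrow> nat"
  have range: "c g < d" if "c \<in> ?A" "g \<in> carrier G" for c g
    using that by (auto simp: right_invariant_colourings_def)
  have "tab ` ?A \<subseteq> {..<d} \<times> Pow (T \<times> {..<d} \<times> {..<d})"
    using T(2) range by (auto simp: tab_def subset_iff)
  then have "finite (tab ` ?A)"
    by (rule finite_subset) (use T(1) in simp)
  moreover have "inj_on tab ?A"
  proof (rule inj_onI)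
    fix c e assume c: "c \<in> ?A" and e: "e \<in> ?A" and eq: "tab c = tab e"
    \<comment> \<open>The entry that \<open>g\<close> gives for \<open>c\<close> also occurs for
      \<open>e\<close>, but perhaps through another element \<open>k\<close>. Right invariance of
      \<open>e\<close> passes from \<open>k\<close> to \<open>h\<close>, which has the same
      colour.\<close>
    have gen: "c (g \<otimes> s) = e (h \<otimes> s)"
      if "s \<in> T" "g \<in> carrier G" "h \<in> carrier G" "c g = e h" for s g h
    proof -
      have "(s, c g, c (g \<otimes> s)) \<in> snd (tab e)"
        unfolding eq[symmetric] using that(1,2) by (auto simp: tab_def)
      then obtain k where k: "k \<in> carrier G" "e k = c g" "e (k \<otimes> s) = c (g \<otimes> s)"
        by (auto simp: tab_def)
      have "e k = e h" "s \<in> carrier G"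
        using k that T(2) by auto
      then have "e (k \<otimes> s) = e (h \<otimes> s)"
        using e k(1) that(3) unfolding right_invariant_colourings_def by blast
      with k show ?thesis by simp
    qed
    \<comment> \<open>Quantifying over the starting points lets the product case apply the
      hypothesis for \<open>h2\<close> after the move by \<open>h1\<close>.\<close>
    have "\<forall>g\<in>carrier G. \<forall>h\<in>carrier G. c g = e h \<longrightarrow> c (g \<otimes> t) = e (h \<otimes> t)"
      if "t \<in> generate G S" for t
      using that
    proof induction
      case (eng h1 h2)
      then have "h1 \<in> carrier G" "h2 \<in> carrier G"
        using assms(3) by auto
      with eng.IH show ?case
        by (simp flip: m_assoc)
    qed (auto simp: T_def intro: gen)
    moreover have "c \<one> = e \<one>"
      using eq by (simp add: tab_def)
    ultimately have "c (\<one> \<otimes> t) = e (\<one> \<otimes> t)" if "t \<in> carrier G" for t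
      using that assms(3) one_closed by blast
    then have "c t = e t" if "t \<in> carrier G" for t
      using that by simp
    moreover have "c \<in> carrier G \<rightarrow>\<^sub>E {..<d}" "e \<in> carrier G \<rightarrow>\<^sub>E {..<d}"
      using c e by (auto simp: right_invariant_colourings_def)
    ultimately show "c = e"
      by (rule PiE_ext[rotated 2])
  qed
  ultimately show ?thesis
    by (rule finite_imageD)
qed

text \<open>Right multiplication is well defined on right cosets, so numbering them gives a
  right-invariant colouring from which \<open>H\<close> is read off as the class of
  \<open>\<one>\<close>.\<close>

lemma (in group) finite_subgroups_of_index:
  assumes "finitely_generated_group G" "d \<ge> 1"
  shows "finite (subgroups_of_index G d)"
proof -
  have "subgroups_of_index G d \<subseteq>
      (\<lambda>c. {g \<in> carrier G. c g = c \<one>}) ` right_invariant_colourings G d"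
  proof
    fix H assume "H \<in> subgroups_of_index G d"
    then have H: "subgroup H G" and card: "card (rcosets H) = d"
      by (auto simp: subgroups_of_index_def)
    note sub = subgroup.subset[OF H]
    \<comment> \<open>An infinite set of cosets would have \<open>card\<close> 0, which
      \<open>d \<ge> 1\<close> excludes.\<close>
    have "finite (rcosets H)"
      using card assms(2) by (intro card_ge_0_finite) simp
    then obtain n where n: "bij_betw n (rcosets H) {0..<d}"
      using ex_bij_betw_finite_nat card by blast
    define c where "c = (\<lambda>g\<in>carrier G. n (H #> g))"
    have c_eq: "c g = c h \<longleftrightarrow> H #> g = H #> h" if "g \<in> carrier G" "h \<in> carrier G" for g h
      using that inj_on_eq_iff[OF bij_betw_imp_inj_on[OF n]] rcosetsI[OF sub] by (simp add: c_def)
    have "c \<in> carrier G \<rightarrow>\<^sub>E {..<d}"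
      using bij_betwE[OF n] rcosetsI[OF sub] by (auto simp: c_def)
    then have "c \<in> right_invariant_colourings G d"
      using sub by (simp add: right_invariant_colourings_def c_eq flip: coset_mult_assoc)
    \<comment> \<open>For \<open>g\<close> in the carrier, \<open>H #> g = H\<close> holds exactly
      when \<open>g \<in> H\<close>.\<close>
    moreover have "H = {g \<in> carrier G. c g = c \<one>}"
      using sub coset_join1[OF _ _ H] coset_join2[OF _ H] by (auto simp: c_eq subset_iff)
    ultimately show "H \<in> (\<lambda>c. {g \<in> carrier G. c g = c \<one>}) ` right_invariant_colourings G d"
      by blast
  qed
  moreover obtain S where "finite S" "S \<subseteq> carrier G" "generate G S = carrier G"
    using assms(1) by (auto simp: finitely_generated_group_def)
  ultimately show ?thesis
    using finite_right_invariant_colourings finite_surj by blast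
qed

theorem lemma4p3:
  fixes G :: "('g, 'm) monoid_scheme"
    and X :: "'a topology"
    and \<phi> :: "'g \<Rightarrow> 'a \<Rightarrow> 'a"
    and d :: nat
  assumes "group G"
    and "acts_by_homeomorphisms G X \<phi>"
    and "has_dense_orbit G X \<phi>"
    and "d \<ge> 1"
  shows "clopen_G_partitions G X \<phi> d \<lesssim> subgroups_of_index G d
    \<and> (finite (subgroups_of_index G d) \<longrightarrow> finite (clopen_G_partitions G X \<phi> d))
    \<and> (finitely_generated_group G \<longrightarrow>
          finite (subgroups_of_index G d) \<and> finite (clopen_G_partitions G X \<phi> d))"
proof -
  have le: "clopen_G_partitions G X \<phi> d \<lesssim> subgroups_of_index G d"
    using assms(2,3) by (rule clopen_G_partitions_lepoll_subgroups)
  moreover have "finite (clopen_G_partitions G X \<phi> d)" if "finite (subgroups_of_index G d)"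
    using le that unfolding lepoll_def by (meson inj_on_finite)
  ultimately show ?thesis
    using group.finite_subgroups_of_index[OF assms(1) _ assms(4)] by blast
qed

end
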